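(* Let $\mathbf{D}$ be a nonempty set of rooted communication graphs on $n$ processes (the set of allowed graphs of an oblivious message adversary). If all connected components of $\mathcal{N}_{T}(\mathbf{D})$, where $T=\mathrm{TD}(\mathbf{D})$, are root-compatible, then consensus is solvable under $\mathbf{D}$ by round $c\,(n-1)(\mathrm{TD}+1)$, where $c$ is the number of connected components of $\mathcal{N}_{T}(\mathbf{D})$; that is, there is a correct consensus algorithm in which, in every run, every process has decided by the end of round $c\,(n-1)(\mathrm{TD}+1)$.
   Context: **Model.** $\Pi=\{p_1,\dots,p_n\}$ is a set of $n$ processes. A communication graph is a directed graph on $\Pi$ containing all self-loops; $\mathrm{In}_G(p)=\{q:(q,p)\in E(G)\}$. An oblivious message adversary is given by a nonempty set $\mathbf{D}$ of communication graphs; its admissible infinite communication patterns are all sequences $\sigma=(\sigma(1),\sigma(2),\dots)\in\mathbf{D}^\omega$ with every $\sigma(r)\in\mathbf{D}$; $\mathbf{D}^r$ is the set of length-$r$ patterns. Given inputs $(x_p)_{p\in\Pi}$, views are defined by $\mathrm{view}_\sigma(p,0)=\{(p,0,x_p)\}$ and, for $r\ge1$, $\mathrm{view}_\sigma(p,r)=(p,r,\{\mathrm{view}_\sigma(q,r-1):(q,p)\in\sigma(r)\})$. **Consensus.** Each process $p$ has an input $x_p$ from a finite domain $V$. A (deterministic, full-information) consensus algorithm is a family of decision functions $\Delta_p$ mapping each possible view of $p$ to $V\cup\{\bot\}$ such that if $\Delta_p(\mathrm{view}_\sigma(p,r))\ne\bot$ then $\Delta_p(\mathrm{view}_\sigma(p,r'))=\Delta_p(\mathrm{view}_\sigma(p,r))$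 for all $r'\ge r$. A run is determined by an input assignment and some $\sigma\in\mathbf{D}^\omega$; $p$ has decided $v\neq\bot$ by (the end of) round $r$ if $\Delta_p(\mathrm{view}_\sigma(p,r))=v$. The algorithm is correct under $\mathbf{D}$ if in every run every process eventually decides (termination), no two processes decide differently (agreement), and every decided value is the input of some process (validity). **Roots.** A root component of a graph is a strongly connected component with no incoming edge from outside. A graph $G$ is rooted if it has exactly one root component, whose node set is $\mathrm{Root}(G)$. A set $\mathbf{S}$ of rooted communication graphs is root-compatible if $\bigcap_{G\in\mathbf{S}}\mathrm{Root}(G)\ne\emptyset$. **Refined indistinguishability graphs.** $I(\mathbf{D})$ is the undirected graph with node set $\mathbf{D}$ in which $G,H$ are joined by an edge $e$ iff its label $\ell(e)=\{p\in\Pi:\mathrm{In}_G(p)=\mathrm{In}_H(p)\}$ is nonempty. Put $\mathcal{N}_1=I(\mathbf{D})$. For $i\ge2$, $\mathcal{N}_i=\mathcal{N}_i(\mathbf{D})$ has node set $\mathbf{D}$, and its edges are those edges $e$ of $\mathcal{N}_{i-1}$ for which the connected component of $\mathcal{N}_{i-1}$ containing $e$ contains a node $G$ with $\mathrm{Root}(G)\subseteq\ell(e)$. The decision procedure computes $\mathcal{N}_2,\mathcal{N}_3,\dots$ and stops at the first index $i\ge2$ such that $\mathcal{N}_i=\mathcal{N}_{i-1}$ or all connected components of $\mathcal{N}_i$ are root-compatible; this index is $\mathrm{TD}=\mathrm{TD}(\mathbf{D})$. *)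

theory Defs
  imports Main "HOL-Library.FSet" "HOL-Library.Cardinality"
begin

section \<open>Communication graphs and oblivious message adversaries\<close>

text \<open>
  The processes are the elements of a finite type \<open>'p\<close>, so \<open>n = CARD('p)\<close>.  A pair \<open>(q, p)\<close>
  in a graph is the edge from \<open>q\<close> to \<open>p\<close>.
\<close>

type_synonym 'p digraph = "'p rel"

definition comm_graph :: "'p digraph \<Rightarrow> bool" where
  "comm_graph G \<longleftrightarrow> (\<forall>p. (p, p) \<in> G)"

definition In :: "'p digraph \<Rightarrow> 'p \<Rightarrow> 'p set" where
  "In G p = {q. (q, p) \<in> G}"

text \<open>Communication patterns start with round 1; the value of a pattern at 0 is never used.\<close>

definition admissible :: "'p digraph set \<Rightarrow> (nat \<Rightarrow> 'p digraph) \<Rightarrow> bool" where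
  "admissible D \<sigma> \<longleftrightarrow> (\<forall>r\<ge>1. \<sigma> r \<in> D)"

text \<open>
  \<open>Initial p v\<close> stands for the view \<open>(p, 0, v)\<close>, and \<open>Received p r W\<close> for \<open>(p, r, W)\<close>
  with \<open>r \<ge> 1\<close>.
\<close>

datatype ('p, 'v) view = Initial 'p 'v | Received 'p nat "('p, 'v) view fset"

primrec view_of ::
  "(nat \<Rightarrow> ('p::finite) digraph) \<Rightarrow> ('p \<Rightarrow> 'v) \<Rightarrow> 'p \<Rightarrow> nat \<Rightarrow> ('p, 'v) view" where
  "view_of \<sigma> x p 0 = Initial p (x p)"
| "view_of \<sigma> x p (Suc r) =
     Received p (Suc r) ((\<lambda>q. view_of \<sigma> x q r) |`| Abs_fset (In (\<sigma> (Suc r)) p))"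


section \<open>Consensus\<close>

text \<open>A run is given by an admissible communication pattern and an input assignment.\<close>

definition is_run ::
  "'p digraph set \<Rightarrow> 'v set \<Rightarrow> (nat \<Rightarrow> 'p digraph) \<Rightarrow> ('p \<Rightarrow> 'v) \<Rightarrow> bool" where
  "is_run D V \<sigma> x \<longleftrightarrow> admissible D \<sigma> \<and> (\<forall>p. x p \<in> V)"

text \<open>
  \<open>None\<close> is the value \<open>\<bottom>\<close>.  Both conditions concern only the views that occur in some run,
  since the type of views also contains junk.
\<close>

definition consensus_algorithm ::
  "('p::finite) digraph set \<Rightarrow> 'v set \<Rightarrow> ('p \<Rightarrow> ('p, 'v) view \<Rightarrow> 'v option) \<Rightarrow> bool" where
  "consensus_algorithm D V \<Delta> \<longleftrightarrow>
     (\<forall>\<sigma> x. is_run D V \<sigma> x \<longrightarrow>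
        (\<forall>p r. \<Delta> p (view_of \<sigma> x p r) \<in> insert None (Some ` V)) \<and>
        (\<forall>p r r'. \<Delta> p (view_of \<sigma> x p r) \<noteq> None \<longrightarrow> r \<le> r' \<longrightarrow>
           \<Delta> p (view_of \<sigma> x p r') = \<Delta> p (view_of \<sigma> x p r)))"

definition decided_by ::
  "(('p::finite) \<Rightarrow> ('p, 'v) view \<Rightarrow> 'v option) \<Rightarrow> (nat \<Rightarrow> 'p digraph) \<Rightarrow> ('p \<Rightarrow> 'v) \<Rightarrow>
     'p \<Rightarrow> nat \<Rightarrow> 'v \<Rightarrow> bool" where
  "decided_by \<Delta> \<sigma> x p r v \<longleftrightarrow> \<Delta> p (view_of \<sigma> x p r) = Some v"

definition consensus_termination ::
  "('p::finite) digraph set \<Rightarrow> 'v set \<Rightarrow> ('p \<Rightarrow> ('p, 'v) view \<Rightarrow> 'v option) \<Rightarrow> bool" where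
  "consensus_termination D V \<Delta> \<longleftrightarrow>
     (\<forall>\<sigma> x. is_run D V \<sigma> x \<longrightarrow> (\<forall>p. \<exists>r v. decided_by \<Delta> \<sigma> x p r v))"

definition consensus_agreement ::
  "('p::finite) digraph set \<Rightarrow> 'v set \<Rightarrow> ('p \<Rightarrow> ('p, 'v) view \<Rightarrow> 'v option) \<Rightarrow> bool" where
  "consensus_agreement D V \<Delta> \<longleftrightarrow>
     (\<forall>\<sigma> x. is_run D V \<sigma> x \<longrightarrow>
        (\<forall>p q r s v w. decided_by \<Delta> \<sigma> x p r v \<longrightarrow> decided_by \<Delta> \<sigma> x q s w \<longrightarrow> v = w))"

definition consensus_validity ::
  "('p::finite) digraph set \<Rightarrow> 'v set \<Rightarrow> ('p \<Rightarrow> ('p, 'v) view \<Rightarrow> 'v option) \<Rightarrow> bool" where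
  "consensus_validity D V \<Delta> \<longleftrightarrow>
     (\<forall>\<sigma> x. is_run D V \<sigma> x \<longrightarrow> (\<forall>p r v. decided_by \<Delta> \<sigma> x p r v \<longrightarrow> (\<exists>q. x q = v)))"

definition correct_consensus ::
  "('p::finite) digraph set \<Rightarrow> 'v set \<Rightarrow> ('p \<Rightarrow> ('p, 'v) view \<Rightarrow> 'v option) \<Rightarrow> bool" where
  "correct_consensus D V \<Delta> \<longleftrightarrow>
     consensus_algorithm D V \<Delta> \<and> consensus_termination D V \<Delta> \<and>
     consensus_agreement D V \<Delta> \<and> consensus_validity D V \<Delta>"

definition consensus_solvable_by :: "('p::finite) digraph set \<Rightarrow> 'v set \<Rightarrow> nat \<Rightarrow> bool" where
  "consensus_solvable_by D V R \<longleftrightarrow>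
     (\<exists>\<Delta>. correct_consensus D V \<Delta> \<and>
        (\<forall>\<sigma> x. is_run D V \<sigma> x \<longrightarrow> (\<forall>p. \<exists>v. decided_by \<Delta> \<sigma> x p R v)))"


section \<open>Roots\<close>

definition sccs :: "'p digraph \<Rightarrow> 'p set set" where
  "sccs G = UNIV // {(p, q). (p, q) \<in> G\<^sup>* \<and> (q, p) \<in> G\<^sup>*}"

definition root_component :: "'p digraph \<Rightarrow> 'p set \<Rightarrow> bool" where
  "root_component G C \<longleftrightarrow> C \<in> sccs G \<and> (\<forall>q p. (q, p) \<in> G \<longrightarrow> p \<in> C \<longrightarrow> q \<in> C)"

definition rooted :: "'p digraph \<Rightarrow> bool" where
  "rooted G \<longleftrightarrow> (\<exists>!C. root_component G C)"

text \<open>Meaningful for rooted graphs only.\<close>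

definition Root :: "'p digraph \<Rightarrow> 'p set" where
  "Root G = (THE C. root_component G C)"

definition root_compatible :: "'p digraph set \<Rightarrow> bool" where
  "root_compatible S \<longleftrightarrow> (\<Inter>G\<in>S. Root G) \<noteq> {}"


section \<open>Refined indistinguishability graphs\<close>

text \<open>
  All the undirected graphs below have node set \<open>D\<close> and no loops.  Each is represented by its
  symmetric adjacency relation; the edge joining \<open>G\<close> and \<open>H\<close> is the two pairs \<open>(G, H)\<close>
  and \<open>(H, G)\<close>.
\<close>

definition label :: "'p digraph \<Rightarrow> 'p digraph \<Rightarrow> 'p set" where
  "label G H = {p. In G p = In H p}"

definition components :: "'a set \<Rightarrow> 'a rel \<Rightarrow> 'a set set" where
  "components D E = D // (E\<^sup>* \<inter> D \<times> D)"

definition indist_graph :: "'p digraph set \<Rightarrow> ('p digraph) rel" where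
  "indist_graph D = {(G, H). G \<in> D \<and> H \<in> D \<and> G \<noteq> H \<and> label G H \<noteq> {}}"

definition refine :: "'p digraph set \<Rightarrow> ('p digraph) rel \<Rightarrow> ('p digraph) rel" where
  "refine D E =
     {(G, H) \<in> E. \<exists>C \<in> components D E. G \<in> C \<and> H \<in> C \<and> (\<exists>K\<in>C. Root K \<subseteq> label G H)}"

text \<open>
  \<open>refined_graph D i\<close> is the edge set of \<open>\<N>\<^sub>i\<close> for \<open>i \<ge> 1\<close>; the value at 0 is never used.
\<close>

fun refined_graph :: "'p digraph set \<Rightarrow> nat \<Rightarrow> ('p digraph) rel" where
  "refined_graph D 0 = {}"
| "refined_graph D (Suc 0) = indist_graph D"
| "refined_graph D (Suc (Suc i)) = refine D (refined_graph D (Suc i))"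

definition all_components_root_compatible :: "'p digraph set \<Rightarrow> nat \<Rightarrow> bool" where
  "all_components_root_compatible D i \<longleftrightarrow>
     (\<forall>C \<in> components D (refined_graph D i). root_compatible C)"

text \<open>
  Since \<open>\<N>\<^sub>1, \<N>\<^sub>2, \<dots>\<close> is a decreasing sequence of finite graphs, an index with this property
  exists.
\<close>

definition TD :: "'p digraph set \<Rightarrow> nat" where
  "TD D = (LEAST i. i \<ge> 2 \<and>
     (refined_graph D i = refined_graph D (i - 1) \<or> all_components_root_compatible D i))"

end

theory Submission
  imports Defs
begin

text \<open>
  Suppose a process has the same view at round \<open>R\<close> in the patterns \<open>\<sigma>\<close> and \<open>\<tau>\<close>, and let \<open>S\<^sub>r\<close> be the
  set of processes whose round-\<open>r\<close> state it has heard of.  Then \<open>S\<^sub>r\<close> is contained in the label of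
  the pair \<open>\<sigma>(r), \<tau>(r)\<close>, and the sets grow as \<open>r\<close> decreases.  If \<open>S\<^sub>r\<^sub>-\<^sub>1 = S\<^sub>r\<close>, then \<open>S\<^sub>r\<close> is closed under
  incoming edges of \<open>\<sigma>(r)\<close>, hence contains its root.  Among any \<open>n\<close> rounds there is one such round.
  Therefore, if \<open>\<sigma>(r)\<close> and \<open>\<tau>(r)\<close> are adjacent in \<open>\<N>\<^sub>i\<close> and the \<open>\<N>\<^sub>i\<close>-component of \<open>\<sigma>(r)\<close> is
  visited in \<open>n - 1\<close> later rounds, then \<open>\<sigma>(r)\<close> and \<open>\<tau>(r)\<close> are also adjacent in \<open>\<N>\<^sub>i\<^sub>+\<^sub>1\<close>.
  Discarding, for each \<open>i < TD\<close>, the last \<open>n - 1\<close> visits to each component of \<open>\<N>\<^sub>i\<close> leaves at least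
  \<open>2 c (n - 1)\<close> rounds on which the visited component of \<open>\<N>\<^sub>T\<^sub>D\<close> is invariant under chains of
  indistinguishable runs.  Some component is visited \<open>n - 1\<close> times in these rounds; a common root
  of its graphs has reached everybody in all runs of the chain, so its input can be decided on.
\<close>

section \<open>Roots\<close>

text \<open>A vertex of \<open>S\<close> with the fewest ancestors generates a root component.\<close>

lemma Root_subset_in_closed:
  fixes G :: "('p::finite) digraph"
  assumes "rooted G" "S \<noteq> {}" and closed: "\<And>a b. (a, b) \<in> G \<Longrightarrow> b \<in> S \<Longrightarrow> a \<in> S"
  shows "Root G \<subseteq> S"
proof -
  define anc where "anc q = {a. (a, q) \<in> G\<^sup>*}" for q
  obtain q where q: "q \<in> S" and min: "\<And>a. a \<in> S \<Longrightarrow> card (anc q) \<le> card (anc a)"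
    using assms(2) ex_has_least_nat[of "\<lambda>q. q \<in> S" _ "\<lambda>q. card (anc q)"] by blast
  have sub: "anc q \<subseteq> S"
  proof
    fix a assume "a \<in> anc q"
    then have "(a, q) \<in> G\<^sup>*" by (simp add: anc_def)
    then show "a \<in> S" using q by (induction rule: converse_rtrancl_induct) (auto intro: closed)
  qed
  have conn: "(q, a) \<in> G\<^sup>*" if "a \<in> anc q" for a
  proof -
    have "anc a \<subseteq> anc q" using that unfolding anc_def by (auto intro: rtrancl_trans)
    moreover have "card (anc q) \<le> card (anc a)" using min sub that by blast
    ultimately have "anc a = anc q" by (meson card_seteq finite)
    then show ?thesis by (auto simp: anc_def)
  qed
  have "anc q = {(p, q). (p, q) \<in> G\<^sup>* \<and> (q, p) \<in> G\<^sup>*} `` {q}"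
    using conn by (auto simp: anc_def)
  then have "anc q \<in> sccs G" by (simp only: sccs_def quotientI UNIV_I)
  moreover have "a \<in> anc q" if "(a, b) \<in> G" "b \<in> anc q" for a b
    using that converse_rtrancl_into_rtrancl[of a b G q] by (simp add: anc_def)
  ultimately have "root_component G (anc q)" unfolding root_component_def by blast
  then have "Root G = anc q"
    unfolding Root_def by (rule the1_equality[OF assms(1)[unfolded rooted_def]])
  then show ?thesis using sub by simp
qed


section \<open>Information flow\<close>

text \<open>\<open>(q, p) \<in> flow \<sigma> r s\<close> means that the state of \<open>q\<close> at round \<open>r\<close> has reached \<open>p\<close> by round \<open>s\<close>.\<close>

primrec flow :: "(nat \<Rightarrow> 'p digraph) \<Rightarrow> nat \<Rightarrow> nat \<Rightarrow> 'p rel" where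
  "flow \<sigma> r 0 = Id"
| "flow \<sigma> r (Suc s) = (if r \<le> s then flow \<sigma> r s O \<sigma> (Suc s) else Id)"

lemma flow_self [simp]: "flow \<sigma> r r = Id"
  by (cases r) auto

text \<open>\<open>flow\<close> recurses on the last round; peeling off the first one instead shows
  how the set of heard-of processes changes with \<open>r\<close>.\<close>

lemma flow_rec: "r < s \<Longrightarrow> flow \<sigma> r s = \<sigma> (Suc r) O flow \<sigma> (Suc r) s"
proof (induction s)
  case (Suc s)
  then show ?case
    by (cases "r = s") (auto simp: O_assoc)
qed simp

lemma flow_refl:
  assumes "\<And>r. r \<ge> 1 \<Longrightarrow> comm_graph (\<sigma> r)"
  shows "(p, p) \<in> flow \<sigma> r s"
  using assms by (induction s) (auto simp: comm_graph_def)

text \<open>Every step into a round of \<open>A\<close> contributes at least 1 and no other step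
  loses anything. Applied to sizes of growing sets of processes, this bounds the number of rounds
  with growth.\<close>

lemma strict_steps_card:
  fixes f :: "nat \<Rightarrow> nat"
  assumes "\<And>r. r < R \<Longrightarrow> f r \<le> f (Suc r)"
    and "\<And>r. r < R \<Longrightarrow> Suc r \<in> A \<Longrightarrow> f r < f (Suc r)"
  shows "f 0 + card (A \<inter> {1..R}) \<le> f R"
  using assms
proof (induction R)
  case (Suc R)
  have IH: "f 0 + card (A \<inter> {1..R}) \<le> f R" using Suc by simp
  have eq: "A \<inter> {1..Suc R} = (if Suc R \<in> A then insert (Suc R) (A \<inter> {1..R}) else A \<inter> {1..R})"
    by (auto simp: le_Suc_eq)
  show ?case
  proof (cases "Suc R \<in> A")
    case True
    then have "card (A \<inter> {1..Suc R}) = Suc (card (A \<inter> {1..R}))" using eq by simp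
    then show ?thesis using IH Suc.prems(2)[of R] True by simp
  next
    case False
    then show ?thesis using IH Suc.prems(1)[of R] eq by simp
  qed
qed simp

text \<open>If the set reached by \<open>b\<close> stalls in a round before it is full, its
  complement is closed under incoming edges and so contains the root. This is impossible when
  \<open>b\<close> is in the root, so n - 1 such rounds fill the set from its initial size
  1.\<close>

lemma broadcast:
  fixes \<sigma> :: "nat \<Rightarrow> ('p::finite) digraph"
  assumes comm: "\<And>r. r \<ge> 1 \<Longrightarrow> comm_graph (\<sigma> r)" and rt: "\<And>r. r \<ge> 1 \<Longrightarrow> rooted (\<sigma> r)"
    and A: "A \<subseteq> {1..R}" "\<And>r. r \<in> A \<Longrightarrow> b \<in> Root (\<sigma> r)" "CARD('p) - 1 \<le> card A"
  shows "(b, q) \<in> flow \<sigma> 0 R"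
proof -
  define F where "F r = {q. (b, q) \<in> flow \<sigma> 0 r}" for r
  have mono: "F r \<subseteq> F (Suc r)" for r
    using comm[of "Suc r"] by (auto simp: F_def comm_graph_def)
  have b: "b \<in> F r" for r using flow_refl[OF comm] by (simp add: F_def)
  have grow: "F r = UNIV" if "Suc r \<in> A" "F (Suc r) \<subseteq> F r" for r
  proof (rule ccontr)
    assume "F r \<noteq> UNIV"
    then have "Root (\<sigma> (Suc r)) \<subseteq> - F r"
      using that(2) by (intro Root_subset_in_closed[OF rt]) (auto simp: F_def)
    then show False using A(2)[OF that(1)] b by auto
  qed
  have "F R = UNIV"
  proof (cases "\<exists>r<R. F r = UNIV")
    case True
    then obtain r where "r < R" "F r = UNIV" by blast
    then show ?thesis using lift_Suc_mono_le[of F r R] mono by auto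
  next
    case False
    have "card (F 0) + card (A \<inter> {1..R}) \<le> card (F R)"
    proof (rule strict_steps_card)
      show "card (F r) \<le> card (F (Suc r))" for r using mono by (simp add: card_mono)
      show "card (F r) < card (F (Suc r))" if "r < R" "Suc r \<in> A" for r
        using that grow[of r] mono[of r] False by (intro psubset_card_mono) auto
    qed
    moreover have "card (F 0) = 1" by (simp add: F_def)
    ultimately have "CARD('p) \<le> card (F R)" using A by (simp add: Int_absorb2)
    then show ?thesis by (metis card_seteq finite subset_UNIV)
  qed
  then show ?thesis by (auto simp: F_def)
qed

text \<open>A nonempty set can grow in at most \<open>n - 1\<close> rounds.\<close>

lemma ex_round_Root_heard:
  fixes \<sigma> :: "nat \<Rightarrow> ('p::finite) digraph"
  assumes comm: "\<And>r. r \<ge> 1 \<Longrightarrow> comm_graph (\<sigma> r)" and rt: "\<And>r. r \<ge> 1 \<Longrightarrow> rooted (\<sigma> r)"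
    and A: "A \<subseteq> {1..R}" "CARD('p) \<le> card A"
  shows "\<exists>r\<in>A. Root (\<sigma> r) \<subseteq> {q. (q, p) \<in> flow \<sigma> r R}"
proof -
  define S where "S r = {q. (q, p) \<in> flow \<sigma> r R}" for r
  have mono: "S (Suc r) \<subseteq> S r" if "r < R" for r
    using comm[of "Suc r"] that by (auto simp: S_def flow_rec comm_graph_def)
  have p: "p \<in> S r" for r using flow_refl[OF comm] by (simp add: S_def)
  have "\<exists>r<R. Suc r \<in> A \<and> S r \<subseteq> S (Suc r)"
  proof (rule ccontr)
    assume none: "\<not> ?thesis"
    \<comment> \<open>\<open>S\<close> shrinks as \<open>r\<close> increases, so its complement is
      what grows; it never contains \<open>p\<close>, which caps it at n - 1 elements.\<close>
    have "card (- S 0) + card (A \<inter> {1..R}) \<le> card (- S R)"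
    proof (rule strict_steps_card)
      show "card (- S r) \<le> card (- S (Suc r))" if "r < R" for r
        using mono[OF that] by (simp add: card_mono)
      show "card (- S r) < card (- S (Suc r))" if "r < R" "Suc r \<in> A" for r
        using that mono[of r] none by (intro psubset_card_mono) auto
    qed
    moreover have "card (- S R) < CARD('p)" using p[of R] by (intro psubset_card_mono) auto
    ultimately show False using A by (simp add: Int_absorb2)
  qed
  then obtain r where r: "r < R" "Suc r \<in> A" "S r \<subseteq> S (Suc r)" by blast
  \<comment> \<open>In-neighbours of \<open>S (Suc r)\<close> in round \<open>Suc r\<close> lie in
    \<open>S r\<close>, so a stall means closure under incoming edges.\<close>
  have "Root (\<sigma> (Suc r)) \<subseteq> S (Suc r)"
  proof (rule Root_subset_in_closed[OF rt])
    show "S (Suc r) \<noteq> {}" using p by auto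
    show "a \<in> S (Suc r)" if "(a, b) \<in> \<sigma> (Suc r)" "b \<in> S (Suc r)" for a b
      using that r by (auto simp: S_def flow_rec)
  qed simp
  then show ?thesis using r(2) by (auto simp: S_def)
qed


section \<open>Views\<close>

primrec view_owner :: "('p, 'v) view \<Rightarrow> 'p" where
  "view_owner (Initial p v) = p"
| "view_owner (Received p r W) = p"

lemma view_owner_view_of [simp]: "view_owner (view_of \<sigma> x p r) = p"
  by (cases r) auto

primrec view_round :: "('p, 'v) view \<Rightarrow> nat" where
  "view_round (Initial p v) = 0"
| "view_round (Received p r W) = r"

lemma view_round_view_of [simp]: "view_round (view_of \<sigma> x p r) = r"
  by (cases r) auto

text \<open>Each received view names its owner, so the unordered set of views determines the senders
  and which view came from whom.\<close>

lemma view_of_Suc_eqD: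
  fixes p :: "'p::finite"
  assumes "view_of \<sigma> x p (Suc r) = view_of \<tau> y p (Suc r)"
  shows "In (\<sigma> (Suc r)) p = In (\<tau> (Suc r)) p"
    and "\<And>q. (q, p) \<in> \<sigma> (Suc r) \<Longrightarrow> view_of \<sigma> x q r = view_of \<tau> y q r"
proof -
  have fs: "fset (Abs_fset (X :: 'p set)) = X" for X by (simp add: Abs_fset_inverse)
  have eq: "(\<lambda>q. view_of \<sigma> x q r) ` In (\<sigma> (Suc r)) p = (\<lambda>q. view_of \<tau> y q r) ` In (\<tau> (Suc r)) p"
    (is "?A = ?B")
  proof -
    have "fset ((\<lambda>q. view_of \<sigma> x q r) |`| Abs_fset (In (\<sigma> (Suc r)) p)) =
        fset ((\<lambda>q. view_of \<tau> y q r) |`| Abs_fset (In (\<tau> (Suc r)) p))"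
      using assms by simp
    then show ?thesis by (simp only: fset.set_map fs)
  qed
  then have "view_owner ` ?A = view_owner ` ?B" by (rule arg_cong)
  then show "In (\<sigma> (Suc r)) p = In (\<tau> (Suc r)) p" by (simp add: image_image)
  fix q assume "(q, p) \<in> \<sigma> (Suc r)"
  then have "view_of \<sigma> x q r \<in> ?A" by (simp add: In_def)
  then have "view_of \<sigma> x q r \<in> ?B" unfolding eq .
  then obtain q' where q': "view_of \<sigma> x q r = view_of \<tau> y q' r" by auto
  then have "q = q'" by (metis view_owner_view_of)
  then show "view_of \<sigma> x q r = view_of \<tau> y q r" using q' by simp
qed

lemma view_of_eq_flow:
  fixes p :: "'p::finite"
  assumes "view_of \<sigma> x p s = view_of \<tau> y p s" "(q, p) \<in> flow \<sigma> r s" "r \<le> s"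
  shows "view_of \<sigma> x q r = view_of \<tau> y q r"
  using assms
proof (induction s arbitrary: p)
  case (Suc s)
  show ?case
  proof (cases "r \<le> s")
    case True
    then obtain a where "(q, a) \<in> flow \<sigma> r s" "(a, p) \<in> \<sigma> (Suc s)" using Suc.prems(2) by auto
    then show ?thesis using Suc.IH True view_of_Suc_eqD(2)[OF Suc.prems(1)] by blast
  next
    case False
    then show ?thesis using Suc.prems by (auto simp: le_Suc_eq)
  qed
qed simp


section \<open>Components of the refined graphs\<close>

lemma refined_graph_antimono:
  assumes "1 \<le> i" "i \<le> j"
  shows "refined_graph D j \<subseteq> refined_graph D i"
  using assms(2)
proof (induction j rule: dec_induct)
  case (step j)
  then obtain k where "j = Suc k" using assms(1) by (cases j) auto
  then have "refined_graph D (Suc j) \<subseteq> refined_graph D j" by (auto simp: refine_def)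
  then show ?case using step by blast
qed simp

lemma refined_graph_subset: "refined_graph D i \<subseteq> D \<times> D"
proof (cases i)
  case (Suc k)
  then show ?thesis using refined_graph_antimono[of 1 i D] by (auto simp: indist_graph_def)
qed simp

lemma label_commute: "label G H = label H G"
  by (auto simp: label_def)

lemma sym_refined_graph: "sym (refined_graph D i)"
proof (induction D i rule: refined_graph.induct)
  case (2 D)
  show ?case by (auto simp: sym_def indist_graph_def label_commute)
next
  case (3 D i)
  then show ?case by (auto simp: sym_def refine_def label_commute)
qed (simp add: sym_def)

lemma rtrancl_refined_graph_in:
  "(G, H) \<in> (refined_graph D i)\<^sup>* \<Longrightarrow> G \<in> D \<Longrightarrow> H \<in> D"
proof (induction rule: rtrancl_induct)
  case (step H K)
  then show ?case using refined_graph_subset[of D i] by blast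
qed

lemma rtrancl_refined_graph_sym:
  "(G, H) \<in> (refined_graph D i)\<^sup>* \<Longrightarrow> (H, G) \<in> (refined_graph D i)\<^sup>*"
  by (meson sym_refined_graph sym_rtrancl symD)

lemma components_refined_graph:
  "components D (refined_graph D i) = (\<lambda>G. (refined_graph D i)\<^sup>* `` {G}) ` D"
proof -
  have "((refined_graph D i)\<^sup>* \<inter> D \<times> D) `` {G} = (refined_graph D i)\<^sup>* `` {G}" if "G \<in> D" for G
    using that rtrancl_refined_graph_in by fastforce
  then show ?thesis unfolding components_def quotient_def by auto
qed

lemma refined_graph_SucI:
  assumes "i \<ge> 1" "(G, H) \<in> refined_graph D i" "(G, K) \<in> (refined_graph D i)\<^sup>*"
    "Root K \<subseteq> label G H"
  shows "(G, H) \<in> refined_graph D (Suc i)"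
proof -
  obtain j where j: "i = Suc j" using assms(1) by (cases i) auto
  let ?C = "(refined_graph D i)\<^sup>* `` {G}"
  have "G \<in> D" using assms(2) refined_graph_subset by fast
  then have "?C \<in> components D (refined_graph D i)" by (auto simp: components_refined_graph)
  moreover have "G \<in> ?C" "H \<in> ?C" "K \<in> ?C" using assms by auto
  ultimately have "(G, H) \<in> refine D (refined_graph D i)"
    using assms(2,4) unfolding refine_def by blast
  then show ?thesis by (simp add: j)
qed

text \<open>Deleting edges only splits components: each component of the coarser graph is the
  saturation of one of the finer graph.\<close>

lemma card_components_mono:
  fixes D :: "('p::finite) digraph set"
  assumes "1 \<le> i" "i \<le> j"
  shows "card (components D (refined_graph D i)) \<le> card (components D (refined_graph D j))"
proof -
  have "(refined_graph D i)\<^sup>* `` ((refined_graph D j)\<^sup>* `` {G}) = (refined_graph D i)\<^sup>* `` {G}" for G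
    using rtrancl_mono[OF refined_graph_antimono[OF assms, of D]]
    by (auto intro: rtrancl_trans)
  then have "components D (refined_graph D i) =
      (\<lambda>C. (refined_graph D i)\<^sup>* `` C) ` components D (refined_graph D j)"
    by (simp add: components_refined_graph image_image)
  then show ?thesis by (metis card_image_le finite)
qed

text \<open>The \<open>LEAST\<close> in \<open>TD\<close> is meaningful once some index qualifies;
  otherwise every refinement would lose an edge of a finite graph forever.\<close>

lemma TD_ge_2:
  fixes D :: "('p::finite) digraph set"
  shows "TD D \<ge> 2"
proof -
  have "\<exists>i\<ge>2. refined_graph D i = refined_graph D (i - 1)"
  proof (rule ccontr)
    assume none: "\<not> ?thesis"
    have "card (refined_graph D (Suc k)) + k \<le> card (refined_graph D 1)" for k
    proof (induction k)
      case (Suc k)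
      have "refined_graph D (Suc (Suc k)) \<noteq> refined_graph D (Suc k)"
        using none by (auto dest: spec[of _ "Suc (Suc k)"])
      then have "refined_graph D (Suc (Suc k)) \<subset> refined_graph D (Suc k)"
        using refined_graph_antimono[of "Suc k" "Suc (Suc k)" D] by (simp add: psubset_eq)
      then have "card (refined_graph D (Suc (Suc k))) < card (refined_graph D (Suc k))"
        by (rule psubset_card_mono[rotated]) simp
      then show ?case using Suc by simp
    qed simp
    from this[of "Suc (card (refined_graph D 1))"] show False by simp
  qed
  then have "\<exists>i. i \<ge> 2 \<and> (refined_graph D i = refined_graph D (i - 1) \<or>
      all_components_root_compatible D i)" by blast
  from LeastI_ex[OF this] show ?thesis by (simp add: TD_def)
qed


section \<open>Invariant rounds\<close>

text \<open>
  \<open>stable_rounds D R \<sigma> k\<close> is the set of the rounds up to \<open>R\<close> in which the component of \<open>\<N>\<^sub>k\<^sub>+\<^sub>1\<close>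
  visited by \<open>\<sigma>\<close> cannot be changed by passing to an indistinguishable pattern.
\<close>

primrec stable_rounds ::
  "('p::finite) digraph set \<Rightarrow> nat \<Rightarrow> (nat \<Rightarrow> 'p digraph) \<Rightarrow> nat \<Rightarrow> nat set" where
  "stable_rounds D R \<sigma> 0 = {1..R}"
| "stable_rounds D R \<sigma> (Suc k) = {r \<in> stable_rounds D R \<sigma> k. CARD('p) - 1 \<le>
     card {s \<in> stable_rounds D R \<sigma> k. r < s \<and> (\<sigma> r, \<sigma> s) \<in> (refined_graph D (Suc k))\<^sup>*}}"

lemma stable_rounds_subset: "stable_rounds D R \<sigma> k \<subseteq> {1..R}"
  by (induction k) auto

lemma finite_stable_rounds: "finite (stable_rounds D R \<sigma> k)"
  by (rule finite_subset[OF stable_rounds_subset]) simp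

text \<open>The two claims are proved together: adjacency at level \<open>k\<close> puts
  \<open>\<sigma> r\<close> and \<open>\<tau> r\<close> in one component, so both patterns discard
  the same rounds next. Equality is a separate case because the graphs have no loops.\<close>

lemma stable_rounds_invariant:
  fixes D :: "('p::finite) digraph set"
  assumes comm: "\<And>G. G \<in> D \<Longrightarrow> comm_graph G" and rt: "\<And>G. G \<in> D \<Longrightarrow> rooted G"
    and adm: "admissible D \<sigma>" "admissible D \<tau>"
    and view: "view_of \<sigma> x p R = view_of \<tau> y p R"
  shows "stable_rounds D R \<sigma> k = stable_rounds D R \<tau> k \<and>
    (\<forall>r \<in> stable_rounds D R \<sigma> k. \<sigma> r = \<tau> r \<or> (\<sigma> r, \<tau> r) \<in> refined_graph D (Suc k))"
proof -
  have comm_\<sigma>: "comm_graph (\<sigma> r)" and rt_\<sigma>: "rooted (\<sigma> r)" if "r \<ge> 1" for r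
    using that adm comm rt by (auto simp: admissible_def)
  define S where "S r = {q. (q, p) \<in> flow \<sigma> r R}" for r
  have S_label: "S r \<subseteq> label (\<sigma> r) (\<tau> r)" if r: "1 \<le> r" "r \<le> R" for r
  proof
    fix q assume "q \<in> S r"
    then have "view_of \<sigma> x q r = view_of \<tau> y q r"
      using view_of_eq_flow[OF view] r by (simp add: S_def)
    moreover obtain r' where "r = Suc r'" using r(1) by (cases r) auto
    ultimately show "q \<in> label (\<sigma> r) (\<tau> r)"
      using view_of_Suc_eqD(1)[of \<sigma> x q r' \<tau> y] by (simp add: label_def)
  qed
  have S_Suc: "S (Suc r) \<subseteq> S r" for r
  proof (cases "r < R")
    case True
    then show ?thesis using comm_\<sigma>[of "Suc r"] by (auto simp: S_def flow_rec comm_graph_def)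
  next
    case False
    \<comment> \<open>Starting after round \<open>R\<close>, \<open>flow\<close> is the identity by
      convention, which keeps \<open>S\<close> antitone on all naturals.\<close>
    then have "flow \<sigma> (Suc r) R = Id" by (cases R) auto
    then show ?thesis using flow_refl[of \<sigma>, OF comm_\<sigma>] by (auto simp: S_def)
  qed
  have S_mono: "S s \<subseteq> S r" if "r \<le> s" for r s
    using lift_Suc_antimono_le[of S r s] S_Suc that by blast
  have p: "p \<in> S r" for r using flow_refl[OF comm_\<sigma>] by (simp add: S_def)
  show ?thesis
  proof (induction k)
    case 0
    have "(\<sigma> r, \<tau> r) \<in> indist_graph D" if "1 \<le> r" "r \<le> R" "\<sigma> r \<noteq> \<tau> r" for r
      using that adm S_label[of r] p[of r] by (auto simp: indist_graph_def admissible_def)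
    then show ?case
      by (metis One_nat_def atLeastAtMost_iff refined_graph.simps(2) stable_rounds.simps(1))
  next
    case (Suc k)
    let ?E = "refined_graph D (Suc k)"
    let ?P = "stable_rounds D R \<sigma> k"
    have P: "?P = stable_rounds D R \<tau> k" using Suc by simp
    have E: "(\<sigma> r, \<tau> r) \<in> ?E\<^sup>*" if "r \<in> ?P" for r using Suc that by fastforce
    have "(\<sigma> r, \<sigma> s) \<in> ?E\<^sup>* \<longleftrightarrow> (\<tau> r, \<tau> s) \<in> ?E\<^sup>*" if "r \<in> ?P" "s \<in> ?P" for r s
      using E[OF that(1)] E[OF that(2)] by (meson rtrancl_refined_graph_sym rtrancl_trans)
    then have "{s \<in> ?P. r < s \<and> (\<sigma> r, \<sigma> s) \<in> ?E\<^sup>*} = {s \<in> ?P. r < s \<and> (\<tau> r, \<tau> s) \<in> ?E\<^sup>*}"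
      if "r \<in> ?P" for r using that by blast
    then have "stable_rounds D R \<sigma> (Suc k) = stable_rounds D R \<tau> (Suc k)"
      unfolding stable_rounds.simps P[symmetric] by (intro Collect_cong conj_cong refl) simp
    moreover have "(\<sigma> r, \<tau> r) \<in> refined_graph D (Suc (Suc k))"
      if r: "r \<in> stable_rounds D R \<sigma> (Suc k)" and ne: "\<sigma> r \<noteq> \<tau> r" for r
    proof -
      define L where "L = {s \<in> ?P. r < s \<and> (\<sigma> r, \<sigma> s) \<in> ?E\<^sup>*}"
      have rP: "r \<in> ?P" and L: "CARD('p) - 1 \<le> card L" using r by (auto simp: L_def)
      have sub: "insert r L \<subseteq> {1..R}" using rP stable_rounds_subset[of D R \<sigma> k] by (auto simp: L_def)
      moreover have "r \<notin> L" by (simp add: L_def)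
      moreover have "finite L" using finite_subset[OF sub] by simp
      ultimately have "card (insert r L) = Suc (card L)" by (intro card_insert_disjoint)
      \<comment> \<open>Round \<open>r\<close> and n - 1 later visits make up the n rounds that
        force a root to be heard.\<close>
      then have "CARD('p) \<le> card (insert r L)" using L by linarith
      then obtain s where s: "s \<in> insert r L" "Root (\<sigma> s) \<subseteq> S s"
        using ex_round_Root_heard[of \<sigma> "insert r L" R p] comm_\<sigma> rt_\<sigma> sub by (auto simp: S_def)
      have "r \<le> s" "(\<sigma> r, \<sigma> s) \<in> ?E\<^sup>*" using s(1) by (auto simp: L_def)
      moreover have "Root (\<sigma> s) \<subseteq> label (\<sigma> r) (\<tau> r)"
        using s(2) S_mono[OF \<open>r \<le> s\<close>] S_label[of r] sub by auto
      moreover have "(\<sigma> r, \<tau> r) \<in> ?E" using conjunct2[OF Suc] rP ne by blast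
      ultimately show ?thesis by (intro refined_graph_SucI[of "Suc k"]) auto
    qed
    ultimately show ?case by blast
  qed
qed

lemma card_le_card_image_mult:
  assumes "finite A" "finite B" "f ` A \<subseteq> B" "\<And>b. b \<in> B \<Longrightarrow> card {a \<in> A. f a = b} \<le> m"
  shows "card A \<le> card B * m"
proof -
  have "card A = (\<Sum>b\<in>B. card {a \<in> A. f a = b})"
    using sum.group[OF assms(1-3), of "\<lambda>_. 1", symmetric]
    by (simp only: card_eq_sum)
  also have "\<dots> \<le> card B * m" using sum_bounded_above[of B _ m] assms(4) by simp
  finally show ?thesis .
qed

text \<open>In each component, all discarded visits but the first are among the later visits of the
  first, which number fewer than n - 1. Hence at most n - 1 visits are discarded per
  component.\<close>

lemma card_stable_rounds_Suc:
  fixes D :: "('p::finite) digraph set"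
  assumes "admissible D \<sigma>"
  shows "card (stable_rounds D R \<sigma> k) \<le> card (stable_rounds D R \<sigma> (Suc k)) +
    card (components D (refined_graph D (Suc k))) * (CARD('p) - 1)"
proof -
  let ?P = "stable_rounds D R \<sigma>"
  let ?E = "refined_graph D (Suc k)"
  define later where "later r = {s \<in> ?P k. r < s \<and> (\<sigma> r, \<sigma> s) \<in> ?E\<^sup>*}" for r
  have fin: "finite (?P k)" by (rule finite_stable_rounds)
  have "card (?P k - ?P (Suc k)) \<le> card (components D ?E) * (CARD('p) - 1)"
  proof (rule card_le_card_image_mult[where f = "\<lambda>r. ?E\<^sup>* `` {\<sigma> r}"])
    show "(\<lambda>r. ?E\<^sup>* `` {\<sigma> r}) ` (?P k - ?P (Suc k)) \<subseteq> components D ?E"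
      using stable_rounds_subset[of D R \<sigma> k] assms
      by (force simp: components_refined_graph admissible_def)
  next
    fix C
    let ?X = "{r \<in> ?P k - ?P (Suc k). ?E\<^sup>* `` {\<sigma> r} = C}"
    show "card ?X \<le> CARD('p) - 1"
    proof (cases "?X = {}")
      case False
      define m where "m = Min ?X"
      have finX: "finite ?X" using fin by simp
      then have m: "m \<in> ?X" "\<And>r. r \<in> ?X \<Longrightarrow> m \<le> r" using False Min_in[of ?X] by (auto simp: m_def)
      have "?X - {m} \<subseteq> later m"
      proof
        fix r assume r: "r \<in> ?X - {m}"
        then have "m < r" using m(2)[of r] by simp
        moreover have "\<sigma> r \<in> ?E\<^sup>* `` {\<sigma> m}" using r m(1) by auto
        ultimately show "r \<in> later m" using r by (simp add: later_def)
      qed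
      then have "card (?X - {m}) \<le> card (later m)" using fin by (intro card_mono) (auto simp: later_def)
      moreover have "card (later m) < CARD('p) - 1" using m(1) by (auto simp: later_def)
      ultimately show ?thesis using m(1) finX by (simp add: card_Diff_singleton)
    qed (metis card.empty le0)
  qed (use fin in auto)
  moreover have "card (?P k) = card (?P (Suc k)) + card (?P k - ?P (Suc k))"
  proof -
    have sub: "?P (Suc k) \<subseteq> ?P k" by auto
    show ?thesis
      using card_Diff_subset[OF finite_subset[OF sub fin] sub] card_mono[OF fin sub] by linarith
  qed
  ultimately show ?thesis by simp
qed

lemma card_stable_rounds:
  fixes D :: "('p::finite) digraph set"
  assumes "admissible D \<sigma>" "k < i"
  shows "R \<le> card (stable_rounds D R \<sigma> k) +
    k * (card (components D (refined_graph D i)) * (CARD('p) - 1))"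
  using assms(2)
proof (induction k)
  case (Suc k)
  have "card (components D (refined_graph D (Suc k))) * (CARD('p) - 1) \<le>
      card (components D (refined_graph D i)) * (CARD('p) - 1)"
    using card_components_mono[of "Suc k" i D] Suc.prems by simp
  moreover have "R \<le> card (stable_rounds D R \<sigma> k) +
      k * (card (components D (refined_graph D i)) * (CARD('p) - 1))"
    using Suc by simp
  ultimately show ?case
    using card_stable_rounds_Suc[OF assms(1), of R k] unfolding mult_Suc by linarith
qed simp


section \<open>The algorithm\<close>

definition indist_runs ::
  "('p::finite) digraph set \<Rightarrow> 'v set \<Rightarrow> nat \<Rightarrow> ((nat \<Rightarrow> 'p digraph) \<times> ('p \<Rightarrow> 'v)) rel" where
  "indist_runs D V R = {((\<sigma>, x), (\<tau>, y)). is_run D V \<sigma> x \<and> is_run D V \<tau> y \<and>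
     (\<exists>p. view_of \<sigma> x p R = view_of \<tau> y p R)}"

text \<open>Quantifying over the whole chain makes this predicate the same for all runs of a chain,
  so a choice of \<open>b\<close> by \<open>SOME\<close> is the same too.\<close>

definition common_broadcaster ::
  "('p::finite) digraph set \<Rightarrow> 'v set \<Rightarrow> nat \<Rightarrow> (nat \<Rightarrow> 'p digraph) \<Rightarrow> ('p \<Rightarrow> 'v) \<Rightarrow> 'p \<Rightarrow> bool" where
  "common_broadcaster D V R \<sigma> x b \<longleftrightarrow>
     (\<forall>\<tau> y q. ((\<sigma>, x), (\<tau>, y)) \<in> (indist_runs D V R)\<^sup>* \<longrightarrow> (b, q) \<in> flow \<tau> 0 R)"

lemma ex_common_broadcaster:
  fixes D :: "('p::finite) digraph set"
  assumes comm: "\<And>G. G \<in> D \<Longrightarrow> comm_graph G" and rt: "\<And>G. G \<in> D \<Longrightarrow> rooted G"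
    and run: "is_run D V \<sigma> x"
    and compat: "all_components_root_compatible D i" and i: "1 \<le> i"
    and R: "card (components D (refined_graph D i)) * (CARD('p) - 1) * i \<le> R"
  shows "\<exists>b. common_broadcaster D V R \<sigma> x b"
proof -
  let ?E = "refined_graph D i" and ?P = "\<lambda>\<sigma>. stable_rounds D R \<sigma> (i - 1)"
  let ?c = "card (components D ?E)"
  have adm: "admissible D \<sigma>" using run by (simp add: is_run_def)
  have fin: "finite (?P \<sigma>)" by (rule finite_stable_rounds)
  \<comment> \<open>Reaching level \<open>i - 1\<close>, which protects the components of
    \<open>refined_graph D i\<close>, costs at most \<open>i - 1\<close> blocks of
    \<open>?c * (CARD('p) - 1)\<close> rounds; one block is kept for the pigeonhole
    argument.\<close>
  have "?c * (CARD('p) - 1) + (i - 1) * (?c * (CARD('p) - 1)) = ?c * (CARD('p) - 1) * i"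
    using i by (cases i) (auto simp: algebra_simps)
  then have many: "?c * (CARD('p) - 1) \<le> card (?P \<sigma>)"
    using card_stable_rounds[OF adm, of "i - 1" i R] i R by linarith
  have "\<sigma> 1 \<in> D" using adm by (simp add: admissible_def)
  then have "components D ?E \<noteq> {}" by (auto simp: components_refined_graph)
  then have c: "?c > 0" by (simp add: card_gt_0_iff)
  have "\<exists>C \<in> components D ?E. CARD('p) - 1 \<le> card {r \<in> ?P \<sigma>. ?E\<^sup>* `` {\<sigma> r} = C}"
  proof (rule ccontr)
    assume none: "\<not> ?thesis"
    \<comment> \<open>For n = 1 any component would satisfy the bound, so the truncated
      \<open>CARD('p) - 1 - 1\<close> is a proper decrease.\<close>
    then have n: "CARD('p) - 1 > 0" using \<open>components D ?E \<noteq> {}\<close> by fastforce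
    have "card (?P \<sigma>) \<le> ?c * (CARD('p) - 1 - 1)"
    proof (rule card_le_card_image_mult[where f = "\<lambda>r. ?E\<^sup>* `` {\<sigma> r}"])
      show "(\<lambda>r. ?E\<^sup>* `` {\<sigma> r}) ` ?P \<sigma> \<subseteq> components D ?E"
        using stable_rounds_subset[of D R \<sigma> "i - 1"] adm
        by (force simp: components_refined_graph admissible_def)
    qed (use fin none in force)+
    also have "\<dots> < ?c * (CARD('p) - 1)" using c n by simp
    finally show False using many by simp
  qed
  then obtain C where C: "C \<in> components D ?E"
    "CARD('p) - 1 \<le> card {r \<in> ?P \<sigma>. ?E\<^sup>* `` {\<sigma> r} = C}" (is "_ \<le> card ?A") by blast
  obtain b where b: "\<And>G. G \<in> C \<Longrightarrow> b \<in> Root G"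
    using compat C(1) unfolding all_components_root_compatible_def root_compatible_def by blast
  have "common_broadcaster D V R \<sigma> x b" unfolding common_broadcaster_def
  proof (intro allI impI)
    fix \<tau> y q assume chain: "((\<sigma>, x), (\<tau>, y)) \<in> (indist_runs D V R)\<^sup>*"
    then have inv: "is_run D V \<tau> y \<and> ?P \<sigma> = ?P \<tau> \<and> (\<forall>r \<in> ?P \<sigma>. (\<sigma> r, \<tau> r) \<in> ?E\<^sup>*)"
    proof (induction rule: rtrancl_induct2)
      case refl
      then show ?case using run by simp
    next
      case (step \<tau> y \<rho> z)
      then obtain p where run': "is_run D V \<rho> z" and view: "view_of \<tau> y p R = view_of \<rho> z p R"
        by (auto simp: indist_runs_def)
      have adm': "admissible D \<tau>" "admissible D \<rho>" using step.IH run' by (auto simp: is_run_def)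
      have "?P \<tau> = ?P \<rho> \<and> (\<forall>r \<in> ?P \<tau>. \<tau> r = \<rho> r \<or> (\<tau> r, \<rho> r) \<in> ?E)"
        using stable_rounds_invariant[OF comm rt adm' view, of "i - 1"] i by simp
      then show ?case using step.IH run' by (metis rtrancl.rtrancl_into_rtrancl)
    qed
    have \<tau>: "\<tau> r \<in> D" if "r \<ge> 1" for r using inv that by (auto simp: is_run_def admissible_def)
    show "(b, q) \<in> flow \<tau> 0 R"
    proof (rule broadcast)
      show "?A \<subseteq> {1..R}" using stable_rounds_subset[of D R \<sigma> "i - 1"] by auto
      show "b \<in> Root (\<tau> r)" if "r \<in> ?A" for r using that inv by (intro b) auto
    qed (use C(2) \<tau> comm rt in auto)
  qed
  then show ?thesis ..
qed

text \<open>All processes wait until round \<open>R\<close> and then decide the input of the chosen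
  broadcaster, which everybody has heard by then.\<close>

lemma solvable_if_common_broadcaster:
  fixes D :: "('p::finite) digraph set" and V :: "'v set"
  assumes comm: "\<And>G. G \<in> D \<Longrightarrow> comm_graph G"
    and ex: "\<And>\<sigma> x. is_run D V \<sigma> x \<Longrightarrow> \<exists>b. common_broadcaster D V R \<sigma> x b"
  shows "consensus_solvable_by D V R"
proof -
  define val where "val = (\<lambda>(\<sigma>, x). x (SOME b. common_broadcaster D V R \<sigma> x b))"
  have val_eq: "val (\<sigma>, x) = val (\<tau>, y)"
    if step: "((\<sigma>, x), (\<tau>, y)) \<in> indist_runs D V R" for \<sigma> x \<tau> y
  proof -
    have rev: "((\<tau>, y), (\<sigma>, x)) \<in> indist_runs D V R"
      using step by (simp add: indist_runs_def) metis
    have "common_broadcaster D V R \<sigma> x = common_broadcaster D V R \<tau> y"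
      unfolding common_broadcaster_def fun_eq_iff
      using step rev by (meson converse_rtrancl_into_rtrancl)
    then obtain b where b: "b = (SOME b. common_broadcaster D V R \<sigma> x b)"
      "b = (SOME b. common_broadcaster D V R \<tau> y b)" by simp
    obtain p where run: "is_run D V \<sigma> x" and p: "view_of \<sigma> x p R = view_of \<tau> y p R"
      using step by (auto simp: indist_runs_def)
    have "common_broadcaster D V R \<sigma> x b" unfolding b(1) using someI_ex[OF ex[OF run]] .
    \<comment> \<open>The view of \<open>p\<close> at round \<open>R\<close> contains the input of
      \<open>b\<close>, so both runs give \<open>b\<close> the same input.\<close>
    then have "(b, p) \<in> flow \<sigma> 0 R" unfolding common_broadcaster_def by blast
    then have "x b = y b" using view_of_eq_flow[OF p, of b 0] by simp
    then show ?thesis by (simp add: val_def flip: b)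
  qed
  \<comment> \<open>A decision may depend on the view only, so it is read off an arbitrary run that
    produces this view at round \<open>R\<close> or later.\<close>
  define occurs where "occurs p w = (\<lambda>(\<sigma>, x). is_run D V \<sigma> x \<and> (\<exists>r\<ge>R. w = view_of \<sigma> x p r))"
    for p and w :: "('p, 'v) view"
  define \<Delta> where "\<Delta> p w =
    (if \<exists>\<rho>. occurs p w \<rho> then Some (val (SOME \<rho>. occurs p w \<rho>)) else None)" for p w
  have late: "\<Delta> p (view_of \<sigma> x p r) = Some (val (\<sigma>, x))"
    if run: "is_run D V \<sigma> x" and r: "r \<ge> R" for \<sigma> x p r
  proof -
    have occ: "occurs p (view_of \<sigma> x p r) (\<sigma>, x)" using run r by (auto simp: occurs_def)
    then obtain \<tau> y where \<rho>: "(\<tau>, y) = (SOME \<rho>. occurs p (view_of \<sigma> x p r) \<rho>)"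
      by (metis surj_pair)
    then have "occurs p (view_of \<sigma> x p r) (\<tau>, y)" using occ someI by metis
    then obtain r' where run': "is_run D V \<tau> y" and r': "view_of \<sigma> x p r = view_of \<tau> y p r'"
      by (auto simp: occurs_def)
    have "r = r'" using arg_cong[OF r', of view_round] by simp
    \<comment> \<open>By the self-loops a later view of \<open>p\<close> still contains its view at
      round \<open>R\<close>.\<close>
    moreover have "(p, p) \<in> flow \<sigma> R r"
      using run comm by (intro flow_refl) (auto simp: is_run_def admissible_def)
    ultimately have "view_of \<sigma> x p R = view_of \<tau> y p R" using view_of_eq_flow r r' by metis
    then have "val (\<sigma>, x) = val (\<tau>, y)" using run run' by (intro val_eq) (auto simp: indist_runs_def)
    then show ?thesis using occ \<rho> by (auto simp: \<Delta>_def)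
  qed
  have early: "\<Delta> p (view_of \<sigma> x p r) = None" if "r < R" for \<sigma> x p r
  proof -
    have "\<not> occurs p (view_of \<sigma> x p r) \<rho>" for \<rho>
      using that by (auto simp: occurs_def dest!: arg_cong[where f = view_round])
    then show ?thesis by (simp add: \<Delta>_def)
  qed
  have dec: "\<Delta> p (view_of \<sigma> x p r) = (if r \<ge> R then Some (val (\<sigma>, x)) else None)"
    if "is_run D V \<sigma> x" for \<sigma> x p r
    using that late early by simp
  have val_in: "\<exists>q. x q = val (\<sigma>, x)" for \<sigma> x by (auto simp: val_def)
  have val_V: "val (\<sigma>, x) \<in> V" if "is_run D V \<sigma> x" for \<sigma> x
    using that val_in by (metis is_run_def)
  have "consensus_algorithm D V \<Delta>"
    unfolding consensus_algorithm_def using val_V by (auto simp: dec)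
  moreover have "consensus_termination D V \<Delta>"
    unfolding consensus_termination_def decided_by_def using late by blast
  moreover have "consensus_agreement D V \<Delta>"
    unfolding consensus_agreement_def decided_by_def by (auto simp: dec split: if_splits)
  moreover have "consensus_validity D V \<Delta>"
    unfolding consensus_validity_def decided_by_def
    by (auto simp: dec split: if_splits intro: val_in)
  moreover have "\<exists>v. decided_by \<Delta> \<sigma> x p R v" if "is_run D V \<sigma> x" for \<sigma> x p
    using late[OF that] by (auto simp: decided_by_def)
  ultimately show ?thesis unfolding consensus_solvable_by_def correct_consensus_def by blast
qed

theorem theorem1:
  fixes D :: "('p::finite) digraph set" and V :: "'v set"
  assumes "D \<noteq> {}"
    and "\<And>G. G \<in> D \<Longrightarrow> comm_graph G"
    and "\<And>G. G \<in> D \<Longrightarrow> rooted G"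
    and "finite V"
    and "all_components_root_compatible D (TD D)"
  shows "consensus_solvable_by D V
           (card (components D (refined_graph D (TD D))) * (CARD('p) - 1) * (TD D + 1))"
proof (rule solvable_if_common_broadcaster)
  show "comm_graph G" if "G \<in> D" for G using assms(2) that .
  show "\<exists>b. common_broadcaster D V
      (card (components D (refined_graph D (TD D))) * (CARD('p) - 1) * (TD D + 1)) \<sigma> x b"
    if "is_run D V \<sigma> x" for \<sigma> x
    \<comment> \<open>The factor \<open>TD D\<close> meets the bound required there, and
      \<open>TD D + 1\<close> exceeds it.\<close>
    using TD_ge_2[of D] by (intro ex_common_broadcaster[OF assms(2,3) that assms(5)]) auto
qed

end
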